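(* There exists a polynomial-time randomized approximation algorithm for \textsc{Temporal Vertex Cover} with expected approximation factor $O(\ln n)$, where $n$ is the number of vertices of the input temporal graph; that is, the algorithm always outputs a temporal vertex cover, and the expected cardinality of its output is at most $O(\ln n)$ times the minimum cardinality of a temporal vertex cover.
   Context: A temporal graph is a pair $(G,\lambda)$ where $G=(V,E)$ is a finite simple undirected graph with $n=|V|$, $m=|E|$, and $\lambda:E\to 2^{\mathbb{N}}$ assigns to every edge a finite nonempty set of positive integer time labels (listed explicitly in the input); edge $e$ is active at each time $t\in\lambda(e)$. The lifetime is $T=\max\{t:t\in\lambda(e),e\in E\}$. A vertex appearance is a pair $(v,t)$ with $v\in V$, $t\in\{1,\dots,T\}$; it temporally covers edge $e$ if $v$ is an endpoint of $e$ and $t\in\lambda(e)$. A temporal vertex cover is a set of vertex appearances temporally covering every edge of $E$. \textsc{Temporal Vertex Cover}: given $(G,\lambda)$, find a temporal vertex cover of minimum cardinality. *)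

theory Defs
  imports
    "HOL-Probability.Probability"
    "HOL-Computational_Algebra.Polynomial"
    "HOL-Library.Landau_Symbols"
    "HOL-Library.Discrete_Functions"
begin

section \<open>Temporal graphs and temporal vertex covers\<close>

record 'v tgraph =
  verts :: "'v set"
  edges :: "'v set set"
  labels :: "'v set \<Rightarrow> nat set"

definition temporal_graph :: "'v tgraph \<Rightarrow> bool" where
  "temporal_graph G \<longleftrightarrow>
     finite (verts G) \<and>
     (\<forall>e\<in>edges G. e \<subseteq> verts G \<and> card e = 2) \<and>
     (\<forall>e\<in>edges G. finite (labels G e) \<and> labels G e \<noteq> {} \<and> 0 \<notin> labels G e)"

text \<open>Inserting 0 only matters for an edgeless graph: its lifetime is 0 and it has no
  vertex appearances.\<close>
definition lifetime :: "'v tgraph \<Rightarrow> nat" where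
  "lifetime G = Max (insert 0 (\<Union>e\<in>edges G. labels G e))"

definition vertex_appearances :: "'v tgraph \<Rightarrow> ('v \<times> nat) set" where
  "vertex_appearances G = verts G \<times> {1..lifetime G}"

definition temporally_covers :: "'v tgraph \<Rightarrow> 'v \<times> nat \<Rightarrow> 'v set \<Rightarrow> bool" where
  "temporally_covers G a e \<longleftrightarrow> fst a \<in> e \<and> snd a \<in> labels G e"

definition temporal_vertex_cover :: "'v tgraph \<Rightarrow> ('v \<times> nat) set \<Rightarrow> bool" where
  "temporal_vertex_cover G S \<longleftrightarrow>
     S \<subseteq> vertex_appearances G \<and> (\<forall>e\<in>edges G. \<exists>a\<in>S. temporally_covers G a e)"

definition min_tvc_card :: "'v tgraph \<Rightarrow> nat" where
  "min_tvc_card G = Min (card ` {S. temporal_vertex_cover G S})"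


section \<open>Randomized programs and their running time\<close>

text \<open>
  The machine model is a while-language over S-expressions, i.e. binary trees whose leaves are
  natural numbers (compare the language WHILE of Jones, Computability and Complexity from a
  Programming Perspective), extended by fair coin tosses. Numbers are measured by their binary
  length and evaluating an expression costs the total size of all intermediate values, so that
  no large value can be produced or inspected in a small amount of time. Hence each program is
  simulated with polynomial overhead by a probabilistic Turing machine, and vice versa.
\<close>

datatype val = Leaf nat | Node val val

fun val_size :: "val \<Rightarrow> nat" where
  "val_size (Leaf n) = Suc (floor_log n)"
| "val_size (Node a b) = Suc (val_size a + val_size b)"

type_synonym store = "nat \<Rightarrow> val"

datatype expr =
    Var nat
  | Const nat
  | Join expr expr
  | Left expr
  | Right expr
  | IsNode expr
  | Equal expr expr
  | Less expr expr
  | Plus expr expr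
  | Minus expr expr

text \<open>The operations are total: an operand of the wrong kind is read as 0 by the numerical
  operations, and the projections of a leaf are the leaf 0.\<close>

fun num_of :: "val \<Rightarrow> nat" where
  "num_of (Leaf n) = n"
| "num_of (Node a b) = 0"

fun left_of :: "val \<Rightarrow> val" where
  "left_of (Leaf n) = Leaf 0"
| "left_of (Node a b) = a"

fun right_of :: "val \<Rightarrow> val" where
  "right_of (Leaf n) = Leaf 0"
| "right_of (Node a b) = b"

fun is_node :: "val \<Rightarrow> bool" where
  "is_node (Leaf n) = False"
| "is_node (Node a b) = True"

definition truth :: "bool \<Rightarrow> val" where
  "truth b = Leaf (if b then 1 else 0)"

primrec eval_expr :: "expr \<Rightarrow> store \<Rightarrow> val" where
  "eval_expr (Var x) s = s x"
| "eval_expr (Const n) s = Leaf n"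
| "eval_expr (Join e f) s = Node (eval_expr e s) (eval_expr f s)"
| "eval_expr (Left e) s = left_of (eval_expr e s)"
| "eval_expr (Right e) s = right_of (eval_expr e s)"
| "eval_expr (IsNode e) s = truth (is_node (eval_expr e s))"
| "eval_expr (Equal e f) s = truth (eval_expr e s = eval_expr f s)"
| "eval_expr (Less e f) s = truth (num_of (eval_expr e s) < num_of (eval_expr f s))"
| "eval_expr (Plus e f) s = Leaf (num_of (eval_expr e s) + num_of (eval_expr f s))"
| "eval_expr (Minus e f) s = Leaf (num_of (eval_expr e s) - num_of (eval_expr f s))"

primrec expr_cost :: "expr \<Rightarrow> store \<Rightarrow> nat" where
  "expr_cost (Var x) s = val_size (eval_expr (Var x) s)"
| "expr_cost (Const n) s = val_size (eval_expr (Const n) s)"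
| "expr_cost (Join e f) s = expr_cost e s + expr_cost f s + val_size (eval_expr (Join e f) s)"
| "expr_cost (Left e) s = expr_cost e s + val_size (eval_expr (Left e) s)"
| "expr_cost (Right e) s = expr_cost e s + val_size (eval_expr (Right e) s)"
| "expr_cost (IsNode e) s = expr_cost e s + val_size (eval_expr (IsNode e) s)"
| "expr_cost (Equal e f) s = expr_cost e s + expr_cost f s + val_size (eval_expr (Equal e f) s)"
| "expr_cost (Less e f) s = expr_cost e s + expr_cost f s + val_size (eval_expr (Less e f) s)"
| "expr_cost (Plus e f) s = expr_cost e s + expr_cost f s + val_size (eval_expr (Plus e f) s)"
| "expr_cost (Minus e f) s = expr_cost e s + expr_cost f s + val_size (eval_expr (Minus e f) s)"

datatype prog =
    Skip
  | Assign nat expr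
  | Toss nat
  | Seq prog prog
  | Cond expr prog prog
  | While expr prog

text \<open>The second component of a configuration is a clock. Every value other than the leaf 0
  counts as true. The mass missing from the resulting subprobability distribution is the
  probability of divergence.\<close>

partial_function (spmf) exec :: "prog \<Rightarrow> store \<Rightarrow> nat \<Rightarrow> (store \<times> nat) spmf" where
  "exec P s t = (case P of
      Skip \<Rightarrow> return_spmf (s, t + 1)
    | Assign x e \<Rightarrow> return_spmf (s(x := eval_expr e s), t + 1 + expr_cost e s)
    | Toss x \<Rightarrow> bind_spmf coin_spmf (\<lambda>b. return_spmf (s(x := truth b), t + 1))
    | Seq P1 P2 \<Rightarrow> bind_spmf (exec P1 s t) (\<lambda>(s', t'). exec P2 s' t')
    | Cond e P1 P2 \<Rightarrow>
        exec (if eval_expr e s \<noteq> Leaf 0 then P1 else P2) s (t + 1 + expr_cost e s)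
    | While e P1 \<Rightarrow>
        if eval_expr e s \<noteq> Leaf 0
        then bind_spmf (exec P1 s (t + 1 + expr_cost e s)) (\<lambda>(s', t'). exec (While e P1) s' t')
        else return_spmf (s, t + 1 + expr_cost e s))"

text \<open>Input and output are passed in variable 0; the result is the joint distribution of the
  output and the running time.\<close>
definition run :: "prog \<Rightarrow> val \<Rightarrow> (val \<times> nat) spmf" where
  "run P x = map_spmf (\<lambda>(s, t). (s 0, t)) (exec P ((\<lambda>_. Leaf 0)(0 := x)) 0)"

text \<open>Worst-case polynomial time: on every input from \<^term>\<open>D\<close> the program halts
  whatever the outcomes of its coin tosses, within the stated time bound.\<close>
definition polynomial_time_on :: "val set \<Rightarrow> prog \<Rightarrow> bool" where
  "polynomial_time_on D P \<longleftrightarrow>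
     (\<exists>p :: nat poly. \<forall>x\<in>D. lossless_spmf (run P x) \<and>
        (\<forall>(y, t)\<in>set_spmf (run P x). t \<le> poly p (val_size x)))"


section \<open>Encoding of instances and solutions\<close>

text \<open>A list is encoded as a right-nested chain of nodes that ends in the leaf 0.\<close>
primrec enc_list :: "('a \<Rightarrow> val) \<Rightarrow> 'a list \<Rightarrow> val" where
  "enc_list f [] = Leaf 0"
| "enc_list f (a # as) = Node (f a) (enc_list f as)"

definition enc_edge :: "nat \<times> nat \<times> nat list \<Rightarrow> val" where
  "enc_edge = (\<lambda>(u, v, ts). Node (Node (Leaf u) (Leaf v)) (enc_list Leaf ts))"

text \<open>An instance is given by the list of its vertices and the list of its edges, each with the
  list of its labels; the lists are without repetitions and in arbitrary order.\<close>
definition encodes_tgraph :: "val \<Rightarrow> nat tgraph \<Rightarrow> bool" where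
  "encodes_tgraph x G \<longleftrightarrow>
     (\<exists>vs es. x = Node (enc_list Leaf vs) (enc_list enc_edge es) \<and>
        distinct vs \<and> set vs = verts G \<and>
        distinct (map (\<lambda>(u, v, ts). {u, v}) es) \<and>
        (\<lambda>(u, v, ts). {u, v}) ` set es = edges G \<and>
        (\<forall>(u, v, ts)\<in>set es. distinct ts \<and> set ts = labels G {u, v}))"

definition tgraph_instances :: "val set" where
  "tgraph_instances = {x. \<exists>G. temporal_graph G \<and> encodes_tgraph x G}"

text \<open>The set of vertex appearances described by a list of pairs of numbers; undefined
  (\<^term>\<open>None\<close>) on values that are not such a list.\<close>
fun dec_appearances :: "val \<Rightarrow> (nat \<times> nat) set option" where
  "dec_appearances (Leaf n) = (if n = 0 then Some {} else None)"
| "dec_appearances (Node (Node (Leaf v) (Leaf t)) y) =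
     map_option (insert (v, t)) (dec_appearances y)"
| "dec_appearances _ = None"

end

theory Submission
  imports
    Defs
    "HOL-Analysis.Harmonic_Numbers"
    "HOL-Real_Asymp.Real_Asymp"
begin

text \<open>Temporal vertex cover is the set cover problem in which each vertex appearance is a set of
  edges, of size at most \<open>n\<close>. The greedy algorithm, which tosses no coins, always picks
  a vertex appearance \<open>a\<close> that covers the largest number \<open>k\<close> of uncovered
  edges. Its analysis compares it with any cover \<open>C\<close> through the potential
  \<open>\<Sum>b\<in>C. H (c b)\<close>, where \<open>c b\<close> counts the uncovered edges in
  \<open>b\<close> and \<open>H\<close> is the harmonic number: if a pick lowers \<open>c b\<close> by
  \<open>d b\<close>, then \<open>H (c b)\<close> drops by at least \<open>d b / k\<close>, and the
  \<open>d b\<close> add up to at least \<open>k\<close> because \<open>C\<close> covers the edges that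
  \<open>a\<close> removes. So every pick costs one unit of potential, which is initially at most
  \<open>card C * H n\<close>.

  The running time is bounded compositionally: every register holds a value of size at most a
  fixed \<open>M\<close>, so that every elementary step costs at most \<open>7 * M\<close>, and every loop
  over a stored list makes at most \<open>M\<close> rounds.\<close>

section \<open>Total correctness with a time bound\<close>

text \<open>The final store and the time used do not depend on coin tosses or on the initial
  clock.\<close>
definition runs :: "prog \<Rightarrow> store \<Rightarrow> nat \<Rightarrow> (store \<Rightarrow> bool) \<Rightarrow> bool" where
  "runs P s c Q \<longleftrightarrow>
     (\<exists>s' d. d \<le> c \<and> Q s' \<and> (\<forall>t. exec P s t = return_spmf (s', t + d)))"

lemma runsI:
  "(\<And>t. exec P s t = return_spmf (s', t + d)) \<Longrightarrow> d \<le> c \<Longrightarrow> Q s' \<Longrightarrow> runs P s c Q"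
  unfolding runs_def by blast

lemma runsE:
  assumes "runs P s c Q"
  obtains s' d where "d \<le> c" "Q s'" "\<And>t. exec P s t = return_spmf (s', t + d)"
  using assms unfolding runs_def by blast

lemma runs_mono:
  assumes "runs P s c Q" "c \<le> c'" "\<And>s'. Q s' \<Longrightarrow> Q' s'"
  shows "runs P s c' Q'"
  using assms unfolding runs_def by (meson le_trans)

lemma runs_Skip: "Q s \<Longrightarrow> runs Skip s 1 Q"
  by (rule runsI[where d = 1]) (simp_all add: exec.simps)

lemma runs_Assign_cost:
  "Q (s(x := eval_expr e s)) \<Longrightarrow> runs (Assign x e) s (1 + expr_cost e s) Q"
  by (rule runsI[where d = "1 + expr_cost e s"]) (simp_all add: exec.simps)

lemma runs_Seq:
  assumes P: "runs P s c R" and P': "\<And>s'. R s' \<Longrightarrow> runs P' s' c' Q"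
  shows "runs (Seq P P') s (c + c') Q"
proof -
  obtain s1 d1 where 1: "d1 \<le> c" "R s1" "\<And>t. exec P s t = return_spmf (s1, t + d1)"
    using P by (rule runsE) blast
  obtain s2 d2 where 2: "d2 \<le> c'" "Q s2" "\<And>t. exec P' s1 t = return_spmf (s2, t + d2)"
    using P'[OF 1(2)] by (rule runsE) blast
  show ?thesis
    by (rule runsI[where d = "d1 + d2" and s' = s2])
       (use 1 2 in \<open>simp_all add: exec.simps[of "Seq P P'"] add.assoc\<close>)
qed

lemma runs_Cond_cost:
  assumes "runs (if eval_expr e s \<noteq> Leaf 0 then P else P') s c Q"
  shows "runs (Cond e P P') s (1 + expr_cost e s + c) Q"
proof -
  obtain s1 d1 where 1: "d1 \<le> c" "Q s1"
    "\<And>t. exec (if eval_expr e s \<noteq> Leaf 0 then P else P') s t = return_spmf (s1, t + d1)"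
    using assms by (rule runsE) blast
  show ?thesis
    by (rule runsI[where d = "1 + expr_cost e s + d1" and s' = s1])
       (use 1 in \<open>simp_all add: exec.simps[of "Cond e P P'"] add.assoc del: if_split\<close>)
qed

text \<open>The index \<open>n\<close> of the invariant is a strictly decreasing variant, so there
  are at most \<open>n\<close> rounds, each charged \<open>k\<close> for the guard and
  \<open>c\<close> for the body; the last \<open>k\<close> pays for the guard test that ends the
  loop.\<close>

lemma runs_While_cost:
  assumes init: "I n s"
    and cost: "\<And>n s. I n s \<Longrightarrow> 1 + expr_cost e s \<le> k"
    and body: "\<And>n s. I n s \<Longrightarrow> eval_expr e s \<noteq> Leaf 0 \<Longrightarrow> runs P s c (\<lambda>s'. \<exists>m<n. I m s')"
    and final: "\<And>n s. I n s \<Longrightarrow> eval_expr e s = Leaf 0 \<Longrightarrow> Q s"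
  shows "runs (While e P) s (n * (k + c) + k) Q"
  using init
proof (induction n arbitrary: s rule: less_induct)
  case (less n)
  show ?case
  proof (cases "eval_expr e s = Leaf 0")
    case True
    then show ?thesis
      using cost[OF less.prems] final[OF less.prems]
      by (intro runsI[where d = "1 + expr_cost e s" and s' = s])
         (simp_all add: exec.simps[of "While e P"])
  next
    case False
    obtain s1 d1 m where 1: "d1 \<le> c" "m < n" "I m s1"
      "\<And>t. exec P s t = return_spmf (s1, t + d1)"
      using body[OF less.prems False] by (rule runsE) blast
    obtain s2 d2 where 2: "d2 \<le> m * (k + c) + k" "Q s2"
      "\<And>t. exec (While e P) s1 t = return_spmf (s2, t + d2)"
      using less.IH[OF 1(2,3)] by (rule runsE) blast
    \<comment> \<open>The gap between \<open>m\<close> and \<open>n\<close> pays for the round just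
      executed.\<close>
    have "Suc m * (k + c) \<le> n * (k + c)"
      using 1(2) by (intro mult_le_mono1) simp
    then have "1 + expr_cost e s + d1 + d2 \<le> n * (k + c) + k"
      using cost[OF less.prems] 1(1) 2(1) by simp
    then show ?thesis
      using False 1 2
      by (intro runsI[where d = "1 + expr_cost e s + d1 + d2" and s' = s2])
         (simp_all add: exec.simps[of "While e P" s] add.assoc)
  qed
qed

section \<open>Uniform bounds on the cost of expressions\<close>

lemma val_size_pos [simp]: "0 < val_size v"
  by (cases v) auto

lemma floor_log_le_self: "floor_log n \<le> n"
  using order.strict_trans2[OF less_exp[of "floor_log n"] floor_log_exp2_le[of n]]
  by (cases "n = 0") auto

text \<open>A sum is at most twice the larger summand, and doubling adds a single bit.\<close>

lemma floor_log_add_le: "floor_log (a + b) \<le> Suc (floor_log a + floor_log b)"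
proof (cases "a + b = 0")
  case False
  have "floor_log (a + b) \<le> floor_log (2 * max a b)"
    by (rule floor_log_le_iff) simp
  also have "\<dots> = Suc (floor_log (max a b))"
    using False by (intro floor_log_twice) auto
  also have "\<dots> \<le> Suc (floor_log a + floor_log b)"
    by (simp add: max_def)
  finally show ?thesis .
qed simp

lemma val_size_left_of: "val_size (left_of v) \<le> val_size v"
  and val_size_right_of: "val_size (right_of v) \<le> val_size v"
  by (cases v; simp)+

lemma val_size_truth [simp]: "val_size (truth b) = 1"
  by (simp add: truth_def)

lemma truth_eq_0_iff [simp]: "truth b = Leaf 0 \<longleftrightarrow> \<not> b"
  by (simp add: truth_def)

lemma truth_simps [simp]: "truth True = Leaf 1" "truth False = Leaf 0"
  by (simp_all add: truth_def)

lemma floor_log_num_of: "Suc (floor_log (num_of v)) \<le> val_size v"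
  by (cases v) auto

lemma val_size_eval_le_cost: "val_size (eval_expr e s) \<le> expr_cost e s"
  by (cases e) auto

lemma expr_cost_pos [simp]: "0 < expr_cost e s"
  using val_size_eval_le_cost[of e s] val_size_pos[of "eval_expr e s"] by linarith

section \<open>Stores of bounded size and linear cost bounds\<close>

definition store_bounded :: "nat \<Rightarrow> store \<Rightarrow> bool" where
  "store_bounded M s \<longleftrightarrow> (\<forall>i. val_size (s i) \<le> M)"

lemma store_boundedD: "store_bounded M s \<Longrightarrow> val_size (s i) \<le> M"
  by (simp add: store_bounded_def)

lemma store_bounded_pos: "store_bounded M s \<Longrightarrow> 1 \<le> M"
  using store_boundedD[of M s 0] val_size_pos[of "s 0"] by linarith

lemma store_bounded_upd: "store_bounded M s \<Longrightarrow> val_size v \<le> M \<Longrightarrow> store_bounded M (s(x := v))"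
  by (simp add: store_bounded_def)

text \<open>The multiple of \<open>M\<close> that pays for an evaluation in a store bounded by
  \<open>M\<close>. A factor 2 appears where the size of the result is bounded through the cost of
  the operands, by \<open>val_size_eval_le_cost\<close>; the charge for a constant is crude, since
  \<open>floor_log n\<close> is replaced by \<open>n\<close>.\<close>

primrec cost_factor :: "expr \<Rightarrow> nat" where
  "cost_factor (Var x) = 1"
| "cost_factor (Const n) = Suc n"
| "cost_factor (Join e f) = 2 * (cost_factor e + cost_factor f) + 1"
| "cost_factor (Left e) = 2 * cost_factor e"
| "cost_factor (Right e) = 2 * cost_factor e"
| "cost_factor (IsNode e) = cost_factor e + 1"
| "cost_factor (Equal e f) = cost_factor e + cost_factor f + 1"
| "cost_factor (Less e f) = cost_factor e + cost_factor f + 1"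
| "cost_factor (Plus e f) = 2 * (cost_factor e + cost_factor f)"
| "cost_factor (Minus e f) = 2 * (cost_factor e + cost_factor f)"

lemma expr_cost_le:
  assumes "store_bounded M s"
  shows "expr_cost e s \<le> cost_factor e * M"
proof (induction e)
  case (Const n)
  then show ?case
    using floor_log_le_self[of n] store_bounded_pos[OF assms] mult_le_mono2[of 1 M "Suc n"] by simp
next
  case (Join e f)
  then show ?case
    using val_size_eval_le_cost[of e s] val_size_eval_le_cost[of f s] store_bounded_pos[OF assms]
    by (simp add: algebra_simps)
next
  case (Left e)
  then show ?case
    using val_size_eval_le_cost[of e s] val_size_left_of[of "eval_expr e s"] by simp
next
  case (Right e)
  then show ?case
    using val_size_eval_le_cost[of e s] val_size_right_of[of "eval_expr e s"] by simp
next
  case (Plus e f)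
  then show ?case
    using floor_log_add_le[of "num_of (eval_expr e s)" "num_of (eval_expr f s)"]
      floor_log_num_of[of "eval_expr e s"] floor_log_num_of[of "eval_expr f s"]
      val_size_eval_le_cost[of e s] val_size_eval_le_cost[of f s]
    by (simp add: algebra_simps)
next
  case (Minus e f)
  have "floor_log (num_of (eval_expr e s) - num_of (eval_expr f s))
      \<le> floor_log (num_of (eval_expr e s))"
    by (rule floor_log_le_iff) simp
  then show ?case
    using Minus floor_log_num_of[of "eval_expr e s"] val_size_eval_le_cost[of e s]
      expr_cost_pos[of f s]
    by (simp add: algebra_simps)
qed (use assms store_bounded_pos[OF assms] in \<open>auto simp: store_boundedD algebra_simps\<close>)

text \<open>The limit 6 is the largest factor in the greedy program, reached by
  \<open>Equal (Var 6) (Right (Left (Var 10)))\<close> and \<open>Plus (Var 7) (Const 1)\<close>.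
  The clock tick is absorbed by one more \<open>M\<close>, as \<open>M\<close> is positive.\<close>

lemma Suc_expr_cost_le:
  assumes "store_bounded M s" "cost_factor e \<le> 6"
  shows "1 + expr_cost e s \<le> 7 * M"
  using expr_cost_le[OF assms(1), of e] mult_le_mono1[OF assms(2), of M] store_bounded_pos[OF assms(1)]
  by linarith

lemma runs_Assign:
  assumes "store_bounded M s" "cost_factor e \<le> 6" "Q (s(x := eval_expr e s))"
  shows "runs (Assign x e) s (7 * M) Q"
  using runs_Assign_cost[of Q, OF assms(3)] Suc_expr_cost_le[OF assms(1,2)] by (rule runs_mono)

lemma runs_Assign_Seq:
  assumes "store_bounded M s" "cost_factor e \<le> 6" "runs P (s(x := eval_expr e s)) c Q"
  shows "runs (Seq (Assign x e) P) s (7 * M + c) Q"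
  by (rule runs_Seq[OF runs_Assign[where Q = "\<lambda>s'. s' = s(x := eval_expr e s)"]])
     (use assms in auto)

text \<open>Both branches share one budget \<open>c\<close>, which keeps the bound independent of
  the guard; a cheaper branch is padded by \<open>runs_mono\<close>.\<close>

lemma runs_Cond:
  assumes "store_bounded M s" "cost_factor e \<le> 6"
    and "eval_expr e s \<noteq> Leaf 0 \<Longrightarrow> runs P s c Q"
    and "eval_expr e s = Leaf 0 \<Longrightarrow> runs P' s c Q"
  shows "runs (Cond e P P') s (7 * M + c) Q"
  by (rule runs_mono[OF runs_Cond_cost[of e s P P' c Q]])
     (use assms Suc_expr_cost_le[OF assms(1,2)] in auto)

lemma runs_Skip': "store_bounded M s \<Longrightarrow> Q s \<Longrightarrow> runs Skip s (7 * M) Q"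
  using store_bounded_pos[of M s] by (intro runs_mono[OF runs_Skip[of Q]]) auto

section \<open>Loops over encoded lists\<close>

lemma val_size_enc_list:
  "val_size (enc_list f xs) = Suc (\<Sum>x\<leftarrow>xs. Suc (val_size (f x)))"
  by (induction xs) auto

lemma length_less_val_size_enc_list: "length xs < val_size (enc_list f xs)"
  by (induction xs) auto

lemma val_size_enc_list_member:
  "x \<in> set xs \<Longrightarrow> val_size (f x) < val_size (enc_list f xs)"
  by (induction xs) auto

lemma val_size_enc_list_filter_le:
  "val_size (enc_list f (filter P xs)) \<le> val_size (enc_list f xs)"
  by (induction xs) auto

lemma val_size_enc_list_rev [simp]: "val_size (enc_list f (rev xs)) = val_size (enc_list f xs)"
  by (simp add: val_size_enc_list rev_map[symmetric] sum_list_rev)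

lemma val_size_enc_list_append_le:
  "val_size (enc_list f xs) \<le> val_size (enc_list f (xs @ ys))"
  by (simp add: val_size_enc_list)

lemma is_node_enc_list [simp]: "is_node (enc_list f xs) \<longleftrightarrow> xs \<noteq> []"
  by (cases xs) auto

definition for_list :: "nat \<Rightarrow> nat \<Rightarrow> prog \<Rightarrow> prog" where
  "for_list l h P =
     While (IsNode (Var l)) (Seq (Assign h (Left (Var l))) (Seq (Assign l (Right (Var l))) P))"

text \<open>At most \<open>M\<close> rounds, each with a guard and two assignments
  (\<open>21 * M\<close>) besides the body, and one final guard test.\<close>

definition loop_time :: "nat \<Rightarrow> nat \<Rightarrow> nat" where
  "loop_time M c = M * (21 * M + c) + 7 * M"

text \<open>The invariant \<open>I\<close> speaks about the prefix already processed. The loop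
  register is advanced before the body starts, so the body only has to leave the remaining suffix
  there.\<close>

lemma runs_for_list:
  assumes bnd: "store_bounded M s" and l: "s l = enc_list f xs" and neq: "l \<noteq> h"
    and init: "I [] s"
    and step: "\<And>ys y zs s. xs = ys @ y # zs \<Longrightarrow> I ys s \<Longrightarrow>
      store_bounded M (s(h := f y, l := enc_list f zs)) \<Longrightarrow>
      runs P (s(h := f y, l := enc_list f zs)) c
        (\<lambda>s'. store_bounded M s' \<and> s' l = enc_list f zs \<and> I (ys @ [y]) s')"
  shows "runs (for_list l h P) s (loop_time M c) (\<lambda>s'. store_bounded M s' \<and> I xs s')"
proof -
  define J where "J n s \<longleftrightarrow>
    (\<exists>ys zs. xs = ys @ zs \<and> n = length zs \<and> store_bounded M s \<and> s l = enc_list f zs \<and> I ys s)" for n s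
  have "runs (for_list l h P) s (length xs * (7 * M + (7 * M + (7 * M + c))) + 7 * M)
      (\<lambda>s'. store_bounded M s' \<and> I xs s')"
    unfolding for_list_def
  proof (rule runs_While_cost[where I = J])
    show "J (length xs) s"
      using bnd l init by (auto simp: J_def)
    show "1 + expr_cost (IsNode (Var l)) s \<le> 7 * M" if "J n s" for n s
      using that by (intro Suc_expr_cost_le) (auto simp: J_def)
    show "store_bounded M s \<and> I xs s" if "J n s" "eval_expr (IsNode (Var l)) s = Leaf 0" for n s
      using that by (auto simp: J_def)
    show "runs (Seq (Assign h (Left (Var l))) (Seq (Assign l (Right (Var l))) P)) s
        (7 * M + (7 * M + c)) (\<lambda>s'. \<exists>m<n. J m s')"
      if "J n s" "eval_expr (IsNode (Var l)) s \<noteq> Leaf 0" for n s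
    proof -
      obtain ys y zs where *: "xs = ys @ y # zs" "n = Suc (length zs)" "store_bounded M s"
        "s l = Node (f y) (enc_list f zs)" "I ys s"
      proof -
        obtain ys zs where "xs = ys @ zs" "n = length zs" "store_bounded M s" "s l = enc_list f zs"
          "I ys s" "zs \<noteq> []"
          using \<open>J n s\<close> \<open>eval_expr (IsNode (Var l)) s \<noteq> Leaf 0\<close> by (auto simp: J_def)
        then show ?thesis
          using that by (cases zs) auto
      qed
      \<comment> \<open>Head and tail are parts of the value in register \<open>l\<close>, so moving
        them into registers keeps the store bounded.\<close>
      have sz: "val_size (f y) \<le> M" "val_size (enc_list f zs) \<le> M"
        using store_boundedD[OF *(3), of l] *(4) by auto
      have b1: "store_bounded M (s(h := f y))"
        and b2: "store_bounded M (s(h := f y, l := enc_list f zs))"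
        using sz *(3) by (auto intro: store_bounded_upd)
      show ?thesis
      proof (intro runs_Assign_Seq)
        have "J (length zs) s'"
          if "store_bounded M s' \<and> s' l = enc_list f zs \<and> I (ys @ [y]) s'" for s'
          unfolding J_def using that *(1) by (intro exI[of _ "ys @ [y]"] exI[of _ zs]) auto
        then have "runs P (s(h := f y, l := enc_list f zs)) c (\<lambda>s'. \<exists>m<n. J m s')"
          by (intro runs_mono[OF step[OF *(1,5) b2]]) (use *(2) in auto)
        then show "runs P (s(h := eval_expr (Left (Var l)) s,
            l := eval_expr (Right (Var l)) (s(h := eval_expr (Left (Var l)) s)))) c
            (\<lambda>s'. \<exists>m<n. J m s')"
          using neq *(4) by simp
      qed (use * b1 in auto)
    qed
  qed
  \<comment> \<open>The list itself sits in a register, and its length is below its size.\<close>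
  moreover have "length xs \<le> M"
    using length_less_val_size_enc_list[of xs f] store_boundedD[OF bnd, of l] l by simp
  then have "length xs * (7 * M + (7 * M + (7 * M + c))) + 7 * M \<le> loop_time M c"
    using mult_le_mono1[of "length xs" M "21 * M + c"] by (simp add: loop_time_def)
  ultimately show ?thesis
    by (rule runs_mono)
qed


section \<open>The greedy choice as a program\<close>

text \<open>The list-level form of \<open>temporally_covers\<close>: it refers only to the encoded
  triple, so the program can be verified without mentioning a graph.\<close>

fun covby :: "nat \<times> nat \<Rightarrow> nat \<times> nat \<times> nat list \<Rightarrow> bool" where
  "covby (w, t) (u, v, ts) \<longleftrightarrow> (w = u \<or> w = v) \<and> t \<in> set ts"

abbreviation covered :: "nat \<times> nat \<Rightarrow> (nat \<times> nat \<times> nat list) list \<Rightarrow> (nat \<times> nat \<times> nat list) list"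
  where "covered a R \<equiv> filter (covby a) R"

abbreviation uncovered :: "nat \<times> nat \<Rightarrow> (nat \<times> nat \<times> nat list) list \<Rightarrow> (nat \<times> nat \<times> nat list) list"
  where "uncovered a R \<equiv> filter (\<lambda>e. \<not> covby a e) R"

text \<open>Registers: 0 input, later the output list; 1 edges still uncovered; 2, 3 iterator and
  current edge, 4, 5 iterator and current label, 6 current endpoint of the candidate search;
  7 number and 8 list of the edges in 1 that the candidate covers and leaves uncovered,
  respectively; 9, 10 iterator and current edge, 11, 16 iterator and current label, 12 result of
  the covering test; 13, 14, 15 best count, its uncovered edges and its vertex appearance.\<close>

definition test_prog :: prog where
  "test_prog =
     Seq (Assign 12 (Const 0)) (Seq (Assign 11 (Right (Var 10)))
     (Seq (for_list 11 16 (Cond (Equal (Var 16) (Var 5)) (Assign 12 (Const 1)) Skip))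
     (Cond (Equal (Var 6) (Left (Left (Var 10)))) Skip
     (Cond (Equal (Var 6) (Right (Left (Var 10)))) Skip (Assign 12 (Const 0))))))"

definition test_time :: "nat \<Rightarrow> nat" where
  "test_time M = 7 * M + (7 * M + (loop_time M (7 * M + 7 * M) + (7 * M + (7 * M + 7 * M))))"

text \<open>The label scan sets register 12 if \<open>t\<close> occurs among the labels; the
  endpoint comparisons afterwards can only clear it. The last conjunct is the frame condition on
  which the calling loops rely.\<close>

lemma runs_test_prog:
  assumes bnd: "store_bounded M s"
    and s: "s 10 = enc_edge e" "s 6 = Leaf w" "s 5 = Leaf t"
  shows "runs test_prog s (test_time M) (\<lambda>s'. store_bounded M s' \<and> s' 12 = truth (covby (w, t) e) \<and>
    (\<forall>i. i \<notin> {11, 12, 16} \<longrightarrow> s' i = s i))"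
proof -
  obtain u v ts where e: "e = (u, v, ts)"
    by (cases e) auto
  have M: "1 \<le> M"
    using bnd by (rule store_bounded_pos)
  have sz: "val_size (enc_list Leaf ts) \<le> M"
    using store_boundedD[OF bnd, of 10] s e by (simp add: enc_edge_def)
  define s1 where "s1 = s(12 := Leaf 0)"
  define s2 where "s2 = s1(11 := enc_list Leaf ts)"
  have b1: "store_bounded M s1"
    unfolding s1_def using bnd M by (intro store_bounded_upd) auto
  have b2: "store_bounded M s2"
    unfolding s2_def using b1 sz by (intro store_bounded_upd) auto
  have s2_11: "s2 11 = enc_list Leaf ts"
    by (simp add: s2_def)
  define I where "I ys s' \<longleftrightarrow>
    s' 12 = truth (t \<in> set ys) \<and> (\<forall>i. i \<notin> {11, 12, 16} \<longrightarrow> s' i = s i)" for ys s'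
  have loop: "runs (for_list 11 16 (Cond (Equal (Var 16) (Var 5)) (Assign 12 (Const 1)) Skip)) s2
      (loop_time M (7 * M + 7 * M)) (\<lambda>s'. store_bounded M s' \<and> I ts s')"
  proof (rule runs_for_list[where f = Leaf])
    show "I [] s2"
      by (simp add: I_def s2_def s1_def truth_def)
    fix ys y zs s'
    assume *: "I ys s'" "store_bounded M (s'(16 := Leaf y, 11 := enc_list Leaf zs))"
    show "runs (Cond (Equal (Var 16) (Var 5)) (Assign 12 (Const 1)) Skip)
        (s'(16 := Leaf y, 11 := enc_list Leaf zs)) (7 * M + 7 * M)
        (\<lambda>s'. store_bounded M s' \<and> s' 11 = enc_list Leaf zs \<and> I (ys @ [y]) s')"
      by (intro runs_Cond runs_Assign runs_Skip')
         (use * M s in \<open>auto simp: I_def intro!: store_bounded_upd\<close>)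
  qed (use b2 s2_11 in auto)
  have final: "runs (Cond (Equal (Var 6) (Left (Left (Var 10)))) Skip
     (Cond (Equal (Var 6) (Right (Left (Var 10)))) Skip (Assign 12 (Const 0)))) s'
     (7 * M + (7 * M + 7 * M)) (\<lambda>s'. store_bounded M s' \<and> s' 12 = truth (covby (w, t) e) \<and>
    (\<forall>i. i \<notin> {11, 12, 16} \<longrightarrow> s' i = s i))" if "store_bounded M s' \<and> I ts s'" for s'
  proof -
    \<comment> \<open>The outer \<open>Skip\<close> must match the budget of the nested
      conditional.\<close>
    have "runs Skip s' (7 * M + 7 * M) Q" if "Q s'" for Q
      using \<open>store_bounded M s' \<and> I ts s'\<close> that by (intro runs_mono[OF runs_Skip'[of M s' Q]]) auto
    then show ?thesis
      by (intro runs_Cond runs_Assign runs_Skip')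
         (use that M s e in \<open>auto simp: I_def enc_edge_def truth_def intro!: store_bounded_upd\<close>)
  qed
  show ?thesis
    unfolding test_prog_def test_time_def
    by (intro runs_Assign_Seq)
       (use bnd b1 s e runs_Seq[OF loop final] in
         \<open>simp_all add: s1_def[symmetric], simp add: s1_def s2_def enc_edge_def\<close>)
qed

section \<open>Splitting the remaining edges by a candidate\<close>

definition split_prog :: prog where
  "split_prog =
     Seq (Assign 7 (Const 0)) (Seq (Assign 8 (Const 0)) (Seq (Assign 9 (Var 1))
       (for_list 9 10 (Seq test_prog
         (Cond (Var 12) (Assign 7 (Plus (Var 7) (Const 1))) (Assign 8 (Join (Var 10) (Var 8))))))))"

definition split_time :: "nat \<Rightarrow> nat" where
  "split_time M = 7 * M + (7 * M + (7 * M + loop_time M (test_time M + (7 * M + 7 * M))))"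

text \<open>The edges left uncovered are pushed onto the front of register 8 and hence end up in
  reverse order, which is harmless since only counts and sets matter later.\<close>

lemma runs_split_prog:
  assumes bnd: "store_bounded M s"
    and s: "s 1 = enc_list enc_edge R" "s 6 = Leaf w" "s 5 = Leaf t"
  shows "runs split_prog s (split_time M) (\<lambda>s'. store_bounded M s' \<and>
    s' 7 = Leaf (length (covered (w, t) R)) \<and>
    s' 8 = enc_list enc_edge (rev (uncovered (w, t) R)) \<and>
    (\<forall>i. i \<notin> {7, 8, 9, 10, 11, 12, 16} \<longrightarrow> s' i = s i))"
proof -
  have M: "1 \<le> M"
    using bnd by (rule store_bounded_pos)
  have szR: "val_size (enc_list enc_edge R) \<le> M"
    using store_boundedD[OF bnd, of 1] s by simp
  define s3 where "s3 = s(7 := Leaf 0, 8 := Leaf 0, 9 := s 1)"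
  have b3: "store_bounded M (s(7 := Leaf 0))" "store_bounded M (s(7 := Leaf 0, 8 := Leaf 0))" "store_bounded M s3"
    unfolding s3_def using bnd M szR s by (auto intro!: store_bounded_upd)
  have s3_9: "s3 9 = enc_list enc_edge R"
    using s by (simp add: s3_def)
  define I where "I ys s' \<longleftrightarrow> s' 7 = Leaf (length (covered (w, t) ys)) \<and>
    s' 8 = enc_list enc_edge (rev (uncovered (w, t) ys)) \<and>
    (\<forall>i. i \<notin> {7, 8, 9, 10, 11, 12, 16} \<longrightarrow> s' i = s i)" for ys s'
  have loop: "runs (for_list 9 10 (Seq test_prog
         (Cond (Var 12) (Assign 7 (Plus (Var 7) (Const 1))) (Assign 8 (Join (Var 10) (Var 8))))))
      s3 (loop_time M (test_time M + (7 * M + 7 * M))) (\<lambda>s'. store_bounded M s' \<and> I R s')"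
  proof (rule runs_for_list[where f = enc_edge])
    show "I [] s3"
      by (simp add: I_def s3_def)
    fix ys y zs s'
    assume *: "R = ys @ y # zs" "I ys s'"
      "store_bounded M (s'(10 := enc_edge y, 9 := enc_list enc_edge zs))"
    \<comment> \<open>Counter and accumulated list stay bounded because both are dominated by the
      size of the whole list \<open>R\<close>, which register 1 holds.\<close>
    have "length (covered (w, t) (ys @ [y])) \<le> length R"
      using length_filter_le[of "covby (w, t)" "ys @ [y]"] *(1) by simp
    then have num: "val_size (Leaf (length (covered (w, t) (ys @ [y])))) \<le> M"
      using floor_log_le_self[of "length (covered (w, t) (ys @ [y]))"]
        length_less_val_size_enc_list[of R enc_edge] szR by simp
    have "val_size (enc_list enc_edge (rev (uncovered (w, t) (ys @ [y]))))
        \<le> val_size (enc_list enc_edge (ys @ [y]))"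
      by (simp only: val_size_enc_list_rev val_size_enc_list_filter_le)
    also have "\<dots> \<le> val_size (enc_list enc_edge ((ys @ [y]) @ zs))"
      by (rule val_size_enc_list_append_le)
    finally have lst: "val_size (enc_list enc_edge (rev (uncovered (w, t) (ys @ [y])))) \<le> M"
      using szR *(1) by simp
    show "runs (Seq test_prog
         (Cond (Var 12) (Assign 7 (Plus (Var 7) (Const 1))) (Assign 8 (Join (Var 10) (Var 8)))))
        (s'(10 := enc_edge y, 9 := enc_list enc_edge zs)) (test_time M + (7 * M + 7 * M))
        (\<lambda>s'. store_bounded M s' \<and> s' 9 = enc_list enc_edge zs \<and> I (ys @ [y]) s')"
    proof (rule runs_Seq[OF runs_test_prog[OF *(3), of y w t]])
      fix s''
      assume "store_bounded M s'' \<and> s'' 12 = truth (covby (w, t) y) \<and> (\<forall>i. i \<notin> {11, 12, 16} \<longrightarrow>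
        s'' i = (s'(10 := enc_edge y, 9 := enc_list enc_edge zs)) i)"
      then show "runs (Cond (Var 12) (Assign 7 (Plus (Var 7) (Const 1)))
          (Assign 8 (Join (Var 10) (Var 8)))) s'' (7 * M + 7 * M)
        (\<lambda>s'. store_bounded M s' \<and> s' 9 = enc_list enc_edge zs \<and> I (ys @ [y]) s')"
        using *(2) num lst
        by (intro runs_Cond runs_Assign) (auto simp: I_def intro!: store_bounded_upd)
    qed (use * s in \<open>auto simp: I_def\<close>)
  qed (use b3 s3_9 in auto)
  then have "runs (for_list 9 10 (Seq test_prog
         (Cond (Var 12) (Assign 7 (Plus (Var 7) (Const 1))) (Assign 8 (Join (Var 10) (Var 8))))))
      s3 (loop_time M (test_time M + (7 * M + 7 * M))) (\<lambda>s'. store_bounded M s' \<and>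
    s' 7 = Leaf (length (covered (w, t) R)) \<and>
    s' 8 = enc_list enc_edge (rev (uncovered (w, t) R)) \<and>
    (\<forall>i. i \<notin> {7, 8, 9, 10, 11, 12, 16} \<longrightarrow> s' i = s i))"
    unfolding I_def .
  then show ?thesis
    unfolding split_prog_def split_time_def
    by (intro runs_Assign_Seq) (use bnd b3 in \<open>simp_all add: s3_def\<close>)
qed

section \<open>Keeping the best candidate\<close>

definition try_prog :: "expr \<Rightarrow> prog" where
  "try_prog we = Seq (Assign 6 we) (Seq split_prog
     (Cond (Less (Var 13) (Var 7))
       (Seq (Assign 13 (Var 7)) (Seq (Assign 14 (Var 8)) (Assign 15 (Join (Var 6) (Var 5)))))
       Skip))"

definition try_time :: "nat \<Rightarrow> nat" where
  "try_time M = 7 * M + (split_time M + (7 * M + (7 * M + (7 * M + 7 * M))))"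

text \<open>\<open>A\<close> is the set of candidates tried so far. A best count of 0 puts no
  condition on registers 14 and 15, so resetting register 13 suffices to start a search.\<close>

definition best :: "(nat \<times> nat \<times> nat list) list \<Rightarrow> (nat \<times> nat) set \<Rightarrow> store \<Rightarrow> bool" where
  "best R A s \<longleftrightarrow> (\<exists>k. s 13 = Leaf k \<and> (\<forall>a\<in>A. length (covered a R) \<le> k) \<and>
     (0 < k \<longrightarrow> (\<exists>w t. s 15 = Node (Leaf w) (Leaf t) \<and> length (covered (w, t) R) = k \<and>
        s 14 = enc_list enc_edge (rev (uncovered (w, t) R)))))"

text \<open>The frame \<open>i<6\<close> protects the output, the edge list and the registers of the
  two enclosing loops. Strictness of the size hypothesis leaves room for the \<open>Node\<close>
  that joins vertex and time in register 15.\<close>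

lemma runs_try_prog:
  assumes bnd: "store_bounded M s"
    and s: "s 1 = enc_list enc_edge R" "s 5 = Leaf t"
    and we: "cost_factor we \<le> 6" "eval_expr we s = Leaf w"
    and sz: "val_size (Leaf w) + val_size (Leaf t) < M"
    and best: "best R A s"
  shows "runs (try_prog we) s (try_time M) (\<lambda>s'. store_bounded M s' \<and> (\<forall>i<6. s' i = s i) \<and>
    best R (insert (w, t) A) s')"
proof -
  have b1: "store_bounded M (s(6 := Leaf w))"
    using bnd sz by (intro store_bounded_upd) auto
  have *: "runs (Cond (Less (Var 13) (Var 7))
       (Seq (Assign 13 (Var 7)) (Seq (Assign 14 (Var 8)) (Assign 15 (Join (Var 6) (Var 5)))))
       Skip) s' (7 * M + (7 * M + (7 * M + 7 * M))) (\<lambda>s'. store_bounded M s' \<and> (\<forall>i<6. s' i = s i) \<and>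
    best R (insert (w, t) A) s')"
    if *: "store_bounded M s' \<and> s' 7 = Leaf (length (covered (w, t) R)) \<and>
      s' 8 = enc_list enc_edge (rev (uncovered (w, t) R)) \<and>
      (\<forall>i. i \<notin> {7, 8, 9, 10, 11, 12, 16} \<longrightarrow> s' i = (s(6 := Leaf w)) i)" for s'
  proof -
    obtain k where k: "s 13 = Leaf k" "\<forall>a\<in>A. length (covered a R) \<le> k"
      "0 < k \<longrightarrow> (\<exists>w t. s 15 = Node (Leaf w) (Leaf t) \<and> length (covered (w, t) R) = k \<and>
        s 14 = enc_list enc_edge (rev (uncovered (w, t) R)))"
      using best unfolding best_def by blast
    show ?thesis
    proof (rule runs_Cond)
      assume "eval_expr (Less (Var 13) (Var 7)) s' \<noteq> Leaf 0"
      then have less: "k < length (covered (w, t) R)"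
        using * k by simp
      define s1 where "s1 = s'(13 := Leaf (length (covered (w, t) R)))"
      define s2 where "s2 = s1(14 := enc_list enc_edge (rev (uncovered (w, t) R)))"
      have "store_bounded M s1"
        unfolding s1_def using * store_boundedD[of M s' 7] by (intro store_bounded_upd) auto
      then have "store_bounded M s2"
        unfolding s2_def using * store_boundedD[of M s' 8] by (intro store_bounded_upd) auto
      \<comment> \<open>The new count exceeds \<open>k\<close>, hence also the count of every
        earlier candidate.\<close>
      have "best R (insert (w, t) A) (s2(15 := Node (Leaf w) (Leaf t)))"
        unfolding best_def using less k(2)
        by (intro exI[of _ "length (covered (w, t) R)"]) (force simp: s2_def s1_def)
      moreover have "store_bounded M (s2(15 := Node (Leaf w) (Leaf t)))"
        using \<open>store_bounded M s2\<close> sz by (intro store_bounded_upd) auto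
      moreover have "\<forall>i<6. (s2(15 := Node (Leaf w) (Leaf t))) i = s i"
        using * by (auto simp: s2_def s1_def)
      ultimately have "runs (Assign 15 (Join (Var 6) (Var 5))) s2 (7 * M)
        (\<lambda>s'. store_bounded M s' \<and> (\<forall>i<6. s' i = s i) \<and> best R (insert (w, t) A) s')"
        using * s \<open>store_bounded M s2\<close> by (intro runs_Assign) (auto simp: s2_def s1_def)
      then have "runs (Seq (Assign 14 (Var 8)) (Assign 15 (Join (Var 6) (Var 5)))) s1 (7 * M + 7 * M)
        (\<lambda>s'. store_bounded M s' \<and> (\<forall>i<6. s' i = s i) \<and> best R (insert (w, t) A) s')"
        using * \<open>store_bounded M s1\<close> by (intro runs_Assign_Seq[of M s1]) (auto simp: s2_def s1_def)
      then show "runs (Seq (Assign 13 (Var 7)) (Seq (Assign 14 (Var 8)) (Assign 15 (Join (Var 6) (Var 5)))))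
        s' (7 * M + (7 * M + 7 * M))
        (\<lambda>s'. store_bounded M s' \<and> (\<forall>i<6. s' i = s i) \<and> best R (insert (w, t) A) s')"
        using * by (intro runs_Assign_Seq[of M s']) (auto simp: s1_def)
    next
      assume "eval_expr (Less (Var 13) (Var 7)) s' = Leaf 0"
      then have "length (covered (w, t) R) \<le> k"
        using * k by simp
      then have "best R (insert (w, t) A) s'"
        unfolding best_def using k * by (intro exI[of _ k]) auto
      moreover have "\<forall>i<6. s' i = s i"
        using * by auto
      ultimately show "runs Skip s' (7 * M + (7 * M + 7 * M))
        (\<lambda>s'. store_bounded M s' \<and> (\<forall>i<6. s' i = s i) \<and> best R (insert (w, t) A) s')"
        using * by (intro runs_mono[OF runs_Skip'[of M s']]) auto
    qed (use * in auto)
  qed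
  have "runs (Seq split_prog
     (Cond (Less (Var 13) (Var 7))
       (Seq (Assign 13 (Var 7)) (Seq (Assign 14 (Var 8)) (Assign 15 (Join (Var 6) (Var 5)))))
       Skip)) (s(6 := Leaf w)) (split_time M + (7 * M + (7 * M + (7 * M + 7 * M))))
     (\<lambda>s'. store_bounded M s' \<and> (\<forall>i<6. s' i = s i) \<and> best R (insert (w, t) A) s')"
    by (rule runs_Seq[OF runs_split_prog[OF b1]]) (use s * in auto)
  then show ?thesis
    unfolding try_prog_def try_time_def using bnd we by (intro runs_Assign_Seq) auto
qed

section \<open>Searching through all useful candidates\<close>

definition search_prog :: prog where
  "search_prog = Seq (Assign 13 (Const 0)) (Seq (Assign 2 (Var 1))
     (for_list 2 3 (Seq (Assign 4 (Right (Var 3)))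
       (for_list 4 5 (Seq (try_prog (Left (Left (Var 3)))) (try_prog (Right (Left (Var 3)))))))))"

definition search_time :: "nat \<Rightarrow> nat" where
  "search_time M =
     7 * M + (7 * M + loop_time M (7 * M + loop_time M (try_time M + try_time M)))"

lemma val_size_enc_edge:
  assumes "t \<in> set ts"
  shows "val_size (Leaf u) + val_size (Leaf t) < val_size (enc_edge (u, v, ts))"
    and "val_size (Leaf v) + val_size (Leaf t) < val_size (enc_edge (u, v, ts))"
  using val_size_enc_list_member[OF assms, of Leaf] by (auto simp: enc_edge_def)

text \<open>It is enough to try the endpoints and labels of the edges in \<open>R\<close>: any other
  appearance covers no edge of \<open>R\<close>, so the best candidate found is best among all
  appearances.\<close>

lemma runs_search_prog:
  assumes bnd: "store_bounded M s" and s: "s 1 = enc_list enc_edge R"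
  shows "runs search_prog s (search_time M) (\<lambda>s'. store_bounded M s' \<and> s' 0 = s 0 \<and>
    best R {a. \<exists>e\<in>set R. covby a e} s')"
proof -
  have M: "1 \<le> M"
    using bnd by (rule store_bounded_pos)
  define s2 where "s2 = s(13 := Leaf 0, 2 := s 1)"
  have b2: "store_bounded M (s(13 := Leaf 0))" "store_bounded M s2"
    unfolding s2_def using bnd M store_boundedD[OF bnd, of 1] by (auto intro!: store_bounded_upd)
  have s2_2: "s2 2 = enc_list enc_edge R"
    using s by (simp add: s2_def)
  define I where "I ys s' \<longleftrightarrow> s' 0 = s 0 \<and> s' 1 = s 1 \<and>
    best R {a. \<exists>e\<in>set ys. covby a e} s'" for ys s'
  let ?inner = "for_list 4 5 (Seq (try_prog (Left (Left (Var 3)))) (try_prog (Right (Left (Var 3)))))"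
  have loop: "runs (for_list 2 3 (Seq (Assign 4 (Right (Var 3))) ?inner)) s2
      (loop_time M (7 * M + loop_time M (try_time M + try_time M))) (\<lambda>s'. store_bounded M s' \<and> I R s')"
  proof (rule runs_for_list[where f = enc_edge])
    show "I [] s2"
      by (simp add: I_def s2_def best_def)
    fix ys e zs s'
    assume *: "R = ys @ e # zs" "I ys s'"
      "store_bounded M (s'(3 := enc_edge e, 2 := enc_list enc_edge zs))"
    obtain u v ts where e: "e = (u, v, ts)"
      by (cases e) auto
    have sz: "val_size (enc_edge e) \<le> M"
      using store_boundedD[OF *(3), of 3] by simp
    define s3 where "s3 = s'(3 := enc_edge e, 2 := enc_list enc_edge zs, 4 := enc_list Leaf ts)"
    have b3: "store_bounded M s3"
      unfolding s3_def by (rule store_bounded_upd[OF *(3)]) (use sz in \<open>simp add: enc_edge_def e\<close>)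
    have s3_4: "s3 4 = enc_list Leaf ts"
      by (simp add: s3_def)
    \<comment> \<open>\<open>A\<close> comes from the edges already finished; the current edge
      contributes both endpoints at each label visited so far.\<close>
    define A where "A = {a. \<exists>e\<in>set ys. covby a e}"
    define J where "J xs s'' \<longleftrightarrow> s'' 0 = s 0 \<and> s'' 1 = s 1 \<and>
      s'' 2 = enc_list enc_edge zs \<and> s'' 3 = enc_edge e \<and> best R (A \<union> {u, v} \<times> set xs) s''" for xs s''
    have "runs ?inner s3 (loop_time M (try_time M + try_time M)) (\<lambda>s'. store_bounded M s' \<and> J ts s')"
    proof (rule runs_for_list[where f = Leaf])
      show "J [] s3"
        using *(2) by (simp add: J_def I_def s3_def A_def best_def)
      fix xs t us s''
      assume **: "ts = xs @ t # us" "J xs s''" "store_bounded M (s''(5 := Leaf t, 4 := enc_list Leaf us))"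
      have szt: "val_size (Leaf u) + val_size (Leaf t) < M" "val_size (Leaf v) + val_size (Leaf t) < M"
        using val_size_enc_edge[of t ts u v] val_size_enc_edge[of t ts v u] **(1) sz e by auto
      show "runs (Seq (try_prog (Left (Left (Var 3)))) (try_prog (Right (Left (Var 3)))))
        (s''(5 := Leaf t, 4 := enc_list Leaf us)) (try_time M + try_time M)
        (\<lambda>s'. store_bounded M s' \<and> s' 4 = enc_list Leaf us \<and> J (xs @ [t]) s')"
      proof (rule runs_Seq[OF runs_try_prog[OF **(3), of R t _ u "A \<union> {u, v} \<times> set xs"]])
        fix s1
        assume s1: "store_bounded M s1 \<and> (\<forall>i<6. s1 i = (s''(5 := Leaf t, 4 := enc_list Leaf us)) i) \<and>
          best R (insert (u, t) (A \<union> {u, v} \<times> set xs)) s1"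
        have eq: "insert (v, t) (insert (u, t) (A \<union> {u, v} \<times> set xs)) = A \<union> {u, v} \<times> set (xs @ [t])"
          by auto
        show "runs (try_prog (Right (Left (Var 3)))) s1 (try_time M)
          (\<lambda>s'. store_bounded M s' \<and> s' 4 = enc_list Leaf us \<and> J (xs @ [t]) s')"
          by (rule runs_mono[OF runs_try_prog[of M s1 R t _ v "insert (u, t) (A \<union> {u, v} \<times> set xs)"]])
             (use s1 ** s szt e in \<open>auto simp: J_def enc_edge_def eq simp del: val_size.simps\<close>)
      qed (use ** s szt e in \<open>auto simp: J_def enc_edge_def best_def simp del: val_size.simps\<close>)
    qed (use b3 s3_4 in auto)
    moreover have "A \<union> {u, v} \<times> set ts = {a. \<exists>e\<in>set (ys @ [e]). covby a e}"
      by (auto simp: A_def e)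
    ultimately have "runs ?inner s3 (loop_time M (try_time M + try_time M))
        (\<lambda>s'. store_bounded M s' \<and> s' 2 = enc_list enc_edge zs \<and> I (ys @ [e]) s')"
      by (auto simp: J_def I_def elim!: runs_mono)
    then show "runs (Seq (Assign 4 (Right (Var 3))) ?inner)
        (s'(3 := enc_edge e, 2 := enc_list enc_edge zs))
        (7 * M + loop_time M (try_time M + try_time M))
        (\<lambda>s'. store_bounded M s' \<and> s' 2 = enc_list enc_edge zs \<and> I (ys @ [e]) s')"
      using *(3) by (intro runs_Assign_Seq) (auto simp: s3_def e enc_edge_def)
  qed (use b2 s2_2 in auto)
  have "runs (for_list 2 3 (Seq (Assign 4 (Right (Var 3))) ?inner)) s2
      (loop_time M (7 * M + loop_time M (try_time M + try_time M)))
      (\<lambda>s'. store_bounded M s' \<and> s' 0 = s 0 \<and> best R {a. \<exists>e\<in>set R. covby a e} s')"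
    by (rule runs_mono[OF loop]) (auto simp: I_def)
  then show ?thesis
    unfolding search_prog_def search_time_def
    by (intro runs_Assign_Seq) (use bnd b2 in \<open>simp_all add: s2_def\<close>)
qed


section \<open>The greedy potential\<close>

text \<open>The difference on the right consists of \<open>p - q\<close> terms \<open>1 / j\<close>
  with \<open>j \<le> k\<close>, each at least \<open>1 / k\<close>.\<close>

lemma harm_diff_ge:
  assumes "q \<le> p" "p \<le> k" "0 < k"
  shows "real (p - q) / real k \<le> harm p - harm q"
  using assms
proof (induction p rule: dec_induct)
  case (step p)
  have "1 / real k \<le> inverse (real (Suc p))"
    using step.prems by (simp add: field_simps)
  moreover have "real (Suc p - q) / real k = real (p - q) / real k + 1 / real k"
    using step.hyps by (simp add: Suc_diff_le add_divide_distrib)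
  ultimately show ?case
    using step by (simp add: harm_Suc)
qed simp

text \<open>The sequence \<open>harm n - ln n\<close> decreases from its value 1 at
  \<open>n = 1\<close>.\<close>

lemma harm_le_ln: "0 < n \<Longrightarrow> harm n \<le> 1 + ln (real n)"
  using euler_mascheroni_sequence_decreasing[of 1 n] by (simp add: harm_expand)

lemma length_covered_split:
  "length (covered b R) = length (covered b (uncovered a R)) + length (covered b (covered a R))"
  by (induction R) auto

text \<open>Double counting: each entry of \<open>R\<close> is counted at least once on the right,
  and once more for every further member of \<open>C\<close> that covers it.\<close>

lemma length_le_sum_covered:
  assumes "finite C" "\<forall>e\<in>set R. \<exists>b\<in>C. covby b e"
  shows "length R \<le> (\<Sum>b\<in>C. length (covered b R))"
  using assms(2)
proof (induction R)
  case (Cons e R)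
  obtain b where b: "b \<in> C" "covby b e"
    using Cons.prems by auto
  have "(\<Sum>b\<in>C. length (covered b (e # R)))
      = (\<Sum>b\<in>C. length (covered b R)) + (\<Sum>b\<in>C. if covby b e then 1 else 0)"
    by (simp add: sum.distrib[symmetric] if_distrib cong: sum.cong) (intro sum.cong, auto)
  moreover have "1 \<le> (\<Sum>b\<in>C. if covby b e then 1 else 0 :: nat)"
    using member_le_sum[of b C "\<lambda>b. if covby b e then 1 else 0 :: nat"] b assms(1) by simp
  ultimately show ?case
    using Cons by simp
qed simp

lemma potential_step:
  assumes C: "finite C" "\<forall>e\<in>set R. \<exists>b\<in>C. covby b e"
    and a: "0 < length (covered a R)"
    and max: "\<And>b. b \<in> C \<Longrightarrow> length (covered b R) \<le> length (covered a R)"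
  shows "1 + (\<Sum>b\<in>C. harm (length (covered b (uncovered a R))))
    \<le> (\<Sum>b\<in>C. harm (length (covered b R)) :: real)"
proof -
  let ?k = "real (length (covered a R))"
  \<comment> \<open>Double counting is applied only to the entries that \<open>a\<close> removes,
    whose number is the denominator.\<close>
  have "1 \<le> (\<Sum>b\<in>C. real (length (covered b (covered a R)))) / ?k"
    using length_le_sum_covered[of C "covered a R"] C a
    by (simp add: of_nat_sum[symmetric] del: of_nat_sum)
  also have "\<dots> = (\<Sum>b\<in>C. real (length (covered b (covered a R))) / ?k)"
    by (simp add: sum_divide_distrib)
  also have "\<dots> \<le> (\<Sum>b\<in>C. harm (length (covered b R)) - harm (length (covered b (uncovered a R))))"
  proof (rule sum_mono)
    fix b assume "b \<in> C"
    then show "real (length (covered b (covered a R))) / ?k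
        \<le> harm (length (covered b R)) - harm (length (covered b (uncovered a R)))"
      \<comment> \<open>Maximality of \<open>a\<close> supplies the premise
        \<open>p \<le> k\<close>.\<close>
      using harm_diff_ge[of "length (covered b (uncovered a R))" "length (covered b R)"
          "length (covered a R)"] max[of b] a length_covered_split[of b R a]
      by (simp only: diff_add_inverse)
  qed
  finally show ?thesis
    by (simp add: sum_subtractf)
qed

section \<open>The greedy algorithm as a program\<close>

fun enc_app :: "nat \<times> nat \<Rightarrow> val" where
  "enc_app (w, t) = Node (Leaf w) (Leaf t)"

lemma dec_appearances_enc_list: "dec_appearances (enc_list enc_app out) = Some (set out)"
  by (induction out) auto

lemma val_size_enc_list_le:
  "(\<And>x. x \<in> set xs \<Longrightarrow> val_size (f x) \<le> N) \<Longrightarrow> val_size (enc_list f xs) \<le> 1 + length xs * (N + 1)"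
  by (induction xs) (fastforce)+

text \<open>The search leaves the edges not covered by its choice in register 14, so they need not
  be filtered again. Register 0 becomes the output once the edge list has been saved.\<close>

definition greedy_prog :: prog where
  "greedy_prog = Seq (Assign 1 (Right (Var 0))) (Seq (Assign 0 (Const 0))
     (While (IsNode (Var 1))
       (Seq search_prog (Seq (Assign 1 (Var 14)) (Assign 0 (Join (Var 15) (Var 0)))))))"

definition greedy_time :: "nat \<Rightarrow> nat" where
  "greedy_time M =
     7 * M + (7 * M + (M * (7 * M + (search_time M + (7 * M + 7 * M))) + 7 * M))"

text \<open>The quadratic \<open>M\<close> makes room for the output: with \<open>N\<close> the
  input size, there are at most \<open>N\<close> appearances of size at most \<open>N\<close>.
  Nonempty label lists guarantee that every round makes progress. The last conjunct compares the
  output with every finite cover \<open>C\<close>, so a minimum can be inserted later.\<close>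

lemma runs_greedy_prog:
  assumes bnd: "store_bounded M s"
    and s: "s 0 = Node v (enc_list enc_edge es)"
    and M: "(val_size (s 0) + 1)\<^sup>2 \<le> M"
    and ts: "\<And>u v ts. (u, v, ts) \<in> set es \<Longrightarrow> ts \<noteq> []"
  shows "runs greedy_prog s (greedy_time M) (\<lambda>s'. \<exists>out. s' 0 = enc_list enc_app out \<and>
    set out \<subseteq> {a. \<exists>e\<in>set es. covby a e} \<and> (\<forall>e\<in>set es. \<exists>a\<in>set out. covby a e) \<and>
    (\<forall>C. finite C \<and> (\<forall>e\<in>set es. \<exists>a\<in>C. covby a e) \<longrightarrow>
      real (length out) \<le> (\<Sum>a\<in>C. harm (length (covered a es)))))"
    (is "runs _ _ _ ?Q")
proof -
  let ?N = "val_size (s 0)"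
  have M1: "1 \<le> M"
    using bnd by (rule store_bounded_pos)
  have szes: "val_size (enc_list enc_edge es) \<le> ?N"
    using s by simp
  have es: "length es \<le> ?N"
    using length_less_val_size_enc_list[of es enc_edge] szes by simp
  have "?N \<le> M"
    by (rule store_boundedD[OF bnd])
  define s2 where "s2 = s(1 := enc_list enc_edge es, 0 := Leaf 0)"
  have b2: "store_bounded M (s(1 := enc_list enc_edge es))" "store_bounded M s2"
    unfolding s2_def using bnd szes \<open>?N \<le> M\<close> M1 by (auto intro!: store_bounded_upd)
  define A where "A = {a. \<exists>e\<in>set es. covby a e}"
  have A: "val_size (enc_app a) \<le> ?N" if a: "a \<in> A" for a
  proof -
    obtain w t u v ts where "a = (w, t)" "(u, v, ts) \<in> set es" "w = u \<or> w = v" "t \<in> set ts"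
      using a unfolding A_def by (cases a) auto
    then show ?thesis
      using val_size_enc_list_member[of "(u, v, ts)" es enc_edge] szes
        val_size_enc_edge[of t ts u v] val_size_enc_edge[of t ts v u] by auto
  qed
  \<comment> \<open>The bound on \<open>length out + length R\<close> controls the size of the
    output; the last conjunct says that the picks made so far are paid for by the drop in
    potential.\<close>
  define J where "J n s' \<longleftrightarrow> (\<exists>R out. n = length R \<and> store_bounded M s' \<and>
    s' 1 = enc_list enc_edge R \<and> s' 0 = enc_list enc_app out \<and>
    set R \<subseteq> set es \<and> set out \<subseteq> A \<and> (\<forall>e\<in>set es - set R. \<exists>a\<in>set out. covby a e) \<and>
    length out + length R \<le> length es \<and>
    (\<forall>C. finite C \<and> (\<forall>e\<in>set es. \<exists>a\<in>C. covby a e) \<longrightarrow>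
      length out + (\<Sum>a\<in>C. harm (length (covered a R))) \<le>
        (\<Sum>a\<in>C. harm (length (covered a es)) :: real)))" for n s'
  have "runs (While (IsNode (Var 1))
       (Seq search_prog (Seq (Assign 1 (Var 14)) (Assign 0 (Join (Var 15) (Var 0)))))) s2
       (length es * (7 * M + (search_time M + (7 * M + 7 * M))) + 7 * M) ?Q"
  proof (rule runs_While_cost[where I = J])
    show "J (length es) s2"
      unfolding J_def using b2 by (intro exI[of _ es] exI[of _ "[]"]) (simp add: s2_def)
    show "1 + expr_cost (IsNode (Var 1)) s' \<le> 7 * M" if "J n s'" for n s'
      using that by (intro Suc_expr_cost_le) (auto simp: J_def)
    \<comment> \<open>At exit \<open>R\<close> is empty: its potential is 0 because
      \<open>harm 0 = 0\<close>, and no edge is exempt from being covered.\<close>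
    show "?Q s'" if "J n s'" "eval_expr (IsNode (Var 1)) s' = Leaf 0" for n s'
      using that unfolding J_def A_def
      by (elim exE conjE, intro exI conjI) (assumption | force simp: harm_expand)+
  next
    fix n s'
    assume "J n s'" and "eval_expr (IsNode (Var 1)) s' \<noteq> Leaf 0"
    then obtain R out where R: "n = length R" "store_bounded M s'"
      "s' 1 = enc_list enc_edge R" "s' 0 = enc_list enc_app out" "R \<noteq> []"
      "set R \<subseteq> set es" "set out \<subseteq> A" "\<forall>e\<in>set es - set R. \<exists>a\<in>set out. covby a e"
      "length out + length R \<le> length es"
      "\<And>C. finite C \<and> (\<forall>e\<in>set es. \<exists>a\<in>C. covby a e) \<Longrightarrow>
        length out + (\<Sum>a\<in>C. harm (length (covered a R))) \<le>
          (\<Sum>a\<in>C. harm (length (covered a es)) :: real)"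
      unfolding J_def by auto
    show "runs (Seq search_prog (Seq (Assign 1 (Var 14)) (Assign 0 (Join (Var 15) (Var 0))))) s'
      (search_time M + (7 * M + 7 * M)) (\<lambda>s'. \<exists>m<n. J m s')"
    proof (rule runs_Seq[OF runs_search_prog[OF R(2,3)]])
      fix s1
      assume s1: "store_bounded M s1 \<and> s1 0 = s' 0 \<and> best R {a. \<exists>e\<in>set R. covby a e} s1"
      then obtain k where k: "\<And>a e. e \<in> set R \<Longrightarrow> covby a e \<Longrightarrow> length (covered a R) \<le> k"
        "0 < k \<longrightarrow> (\<exists>w t. s1 15 = Node (Leaf w) (Leaf t) \<and> length (covered (w, t) R) = k \<and>
          s1 14 = enc_list enc_edge (rev (uncovered (w, t) R)))"
        unfolding best_def by blast
      have pos: "0 < length (covered a R)" if "e \<in> set R" "covby a e" for a e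
        using that by (auto simp: length_greater_0_conv filter_empty_conv)
      \<comment> \<open>Some remaining edge has a first label \<open>t\<close>; the candidate
        \<open>(u, t)\<close> covers it, so the best count is positive.\<close>
      obtain u v t ts where "(u, v, t # ts) \<in> set R"
        using R(5,6) ts by (metis (no_types, opaque_lifting) list.set_intros(1) neq_Nil_conv prod_cases3 subsetD)
      then have "0 < k"
        using k(1)[of "(u, v, t # ts)" "(u, t)"] pos[of "(u, v, t # ts)" "(u, t)"]
        by (simp del: length_greater_0_conv)
      then obtain w t where a: "s1 15 = enc_app (w, t)" "length (covered (w, t) R) = k"
        "s1 14 = enc_list enc_edge (rev (uncovered (w, t) R))"
        using k(2) by auto
      \<comment> \<open>An appearance outside the search covers nothing in \<open>R\<close>, so the
        bound holds for every \<open>b\<close>.\<close>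
      have max: "length (covered b R) \<le> length (covered (w, t) R)" for b
        using k(1)[of _ b] a(2) by (cases "covered b R = []") (auto simp: filter_empty_conv)
      obtain e where "e \<in> set R" "covby (w, t) e"
        using \<open>0 < k\<close> a(2) by (auto simp: filter_empty_conv simp del: covby.simps)
      then have "(w, t) \<in> A"
        using R(6) unfolding A_def by blast
      define R' where "R' = rev (uncovered (w, t) R)"
      define out' where "out' = (w, t) # out"
      have "length R' + k = length R"
        using sum_length_filter_compl[of "covby (w, t)" R] a(2) by (simp add: R'_def)
      then have len: "length R' < length R" "length out' + length R' \<le> length es"
        using \<open>0 < k\<close> R(9) by (auto simp: out'_def)
      \<comment> \<open>A round adds one appearance and removes at least one edge, so the output
        never has more entries than \<open>es\<close>.\<close>
      have "val_size (enc_list enc_app out') \<le> 1 + length out' * (?N + 1)"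
        using A R(7) \<open>(w, t) \<in> A\<close> by (intro val_size_enc_list_le) (auto simp: out'_def)
      also have "\<dots> \<le> 1 + ?N * (?N + 1)"
        using len(2) es by (intro add_mono mult_le_mono) auto
      also have "\<dots> \<le> M"
        using M by (simp add: power2_eq_square)
      finally have sz: "val_size (enc_list enc_app out') \<le> M" .
      define s3 where "s3 = s1(1 := enc_list enc_edge R')"
      have b3: "store_bounded M s3"
        unfolding s3_def using s1 store_boundedD[of M s1 14] a(3)
        by (intro store_bounded_upd) (auto simp: R'_def)
      have b4: "store_bounded M (s3(0 := enc_list enc_app out'))"
        using b3 sz by (rule store_bounded_upd)
      have pot: "length out' + (\<Sum>a\<in>C. harm (length (covered a R'))) \<le>
          (\<Sum>a\<in>C. harm (length (covered a es)) :: real)"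
        if C: "finite C \<and> (\<forall>e\<in>set es. \<exists>a\<in>C. covby a e)" for C
      proof -
        have "\<forall>e\<in>set R. \<exists>a\<in>C. covby a e"
          using C R(6) by blast
        \<comment> \<open>The new appearance is paid for by \<open>potential_step\<close>; reversing
          the list changes no count.\<close>
        then show ?thesis
          using potential_step[of C R "(w, t)"] C R(10)[OF C] max a(2) \<open>0 < k\<close>
          by (simp add: R'_def out'_def rev_filter[symmetric])
      qed
      \<comment> \<open>Every edge that leaves the list in this round is covered by the new
        appearance \<open>(w, t)\<close>.\<close>
      have "J (length R') (s3(0 := enc_list enc_app out'))"
        unfolding J_def
        by (intro exI[of _ R'] exI[of _ out'])
          (use b4 R \<open>(w, t) \<in> A\<close> len(2) pot in \<open>auto simp: s3_def R'_def out'_def simp del: covby.simps\<close>)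
      then have "\<exists>m<n. J m (s3(0 := enc_list enc_app out'))"
        using len(1) R(1) by blast
      then have "runs (Assign 0 (Join (Var 15) (Var 0))) s3 (7 * M) (\<lambda>s'. \<exists>m<n. J m s')"
        using b3 s1 a(1) R(4) by (intro runs_Assign) (auto simp: s3_def out'_def)
      then show "runs (Seq (Assign 1 (Var 14)) (Assign 0 (Join (Var 15) (Var 0)))) s1 (7 * M + 7 * M)
          (\<lambda>s'. \<exists>m<n. J m s')"
        using s1 a(3) by (intro runs_Assign_Seq[of M s1]) (auto simp: s3_def R'_def)
    qed
  qed
  moreover have "length es * (7 * M + (search_time M + (7 * M + 7 * M))) + 7 * M
      \<le> M * (7 * M + (search_time M + (7 * M + 7 * M))) + 7 * M"
    using es \<open>?N \<le> M\<close> by (intro add_right_mono mult_le_mono1) simp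
  ultimately have loop: "runs (While (IsNode (Var 1))
       (Seq search_prog (Seq (Assign 1 (Var 14)) (Assign 0 (Join (Var 15) (Var 0)))))) s2
       (M * (7 * M + (search_time M + (7 * M + 7 * M))) + 7 * M) ?Q"
    by (rule runs_mono)
  show ?thesis
    unfolding greedy_prog_def greedy_time_def
    by (intro runs_Assign_Seq) (use bnd b2 loop s in \<open>simp_all add: s2_def\<close>)
qed

lemma run_greedy_prog:
  assumes x: "x = Node v (enc_list enc_edge es)"
    and ts: "\<And>u v ts. (u, v, ts) \<in> set es \<Longrightarrow> ts \<noteq> []"
  obtains out t where "run greedy_prog x = return_spmf (enc_list enc_app out, t)"
    "t \<le> greedy_time ((val_size x + 1)\<^sup>2)"
    "set out \<subseteq> {a. \<exists>e\<in>set es. covby a e}" "\<forall>e\<in>set es. \<exists>a\<in>set out. covby a e"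
    "\<forall>C. finite C \<and> (\<forall>e\<in>set es. \<exists>a\<in>C. covby a e) \<longrightarrow>
      real (length out) \<le> (\<Sum>a\<in>C. harm (length (covered a es)))"
proof -
  let ?s = "(\<lambda>_. Leaf 0)(0 := x)"
  have "store_bounded ((val_size x + 1)\<^sup>2) ?s"
    by (auto simp: store_bounded_def power2_eq_square)
  then have "runs greedy_prog ?s (greedy_time ((val_size x + 1)\<^sup>2))
    (\<lambda>s'. \<exists>out. s' 0 = enc_list enc_app out \<and>
      set out \<subseteq> {a. \<exists>e\<in>set es. covby a e} \<and> (\<forall>e\<in>set es. \<exists>a\<in>set out. covby a e) \<and>
      (\<forall>C. finite C \<and> (\<forall>e\<in>set es. \<exists>a\<in>C. covby a e) \<longrightarrow>
        real (length out) \<le> (\<Sum>a\<in>C. harm (length (covered a es)))))"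
    by (rule runs_greedy_prog[where v = v]) (use x ts in auto)
  then obtain s' d out where "d \<le> greedy_time ((val_size x + 1)\<^sup>2)" "s' 0 = enc_list enc_app out"
    "set out \<subseteq> {a. \<exists>e\<in>set es. covby a e}" "\<forall>e\<in>set es. \<exists>a\<in>set out. covby a e"
    "\<forall>C. finite C \<and> (\<forall>e\<in>set es. \<exists>a\<in>C. covby a e) \<longrightarrow>
      real (length out) \<le> (\<Sum>a\<in>C. harm (length (covered a es)))"
    "\<And>t. exec greedy_prog ?s t = return_spmf (s', t + d)"
    by (elim runsE exE conjE) (rule that)
  then show ?thesis
    by (intro that[of out d]) (simp_all add: run_def)
qed

section \<open>Polynomial running time\<close>

definition polynomial :: "(nat \<Rightarrow> nat) \<Rightarrow> bool" where
  "polynomial f \<longleftrightarrow> (\<exists>p. \<forall>n. f n = poly p n)"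

lemma polynomial_intros:
  shows polynomial_const: "polynomial (\<lambda>n. c)"
    and polynomial_id: "polynomial (\<lambda>n. n)"
    and polynomial_add: "polynomial f \<Longrightarrow> polynomial g \<Longrightarrow> polynomial (\<lambda>n. f n + g n)"
    and polynomial_mult: "polynomial f \<Longrightarrow> polynomial g \<Longrightarrow> polynomial (\<lambda>n. f n * g n)"
proof -
  show "polynomial (\<lambda>n. c)"
    unfolding polynomial_def by (intro exI[of _ "[:c:]"]) simp
  show "polynomial (\<lambda>n. n)"
    unfolding polynomial_def by (intro exI[of _ "[:0, 1:]"]) simp
  show "polynomial f \<Longrightarrow> polynomial g \<Longrightarrow> polynomial (\<lambda>n. f n + g n)"
    unfolding polynomial_def by (metis poly_add)
  show "polynomial f \<Longrightarrow> polynomial g \<Longrightarrow> polynomial (\<lambda>n. f n * g n)"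
    unfolding polynomial_def by (metis poly_mult)
qed

text \<open>All the time bounds are built from constants and \<open>M\<close> by sums and products,
  so unfolding them leaves only the closure rules.\<close>

lemma polynomial_greedy_time: "polynomial (\<lambda>n. greedy_time ((n + 1)\<^sup>2))"
  unfolding greedy_time_def search_time_def try_time_def split_time_def test_time_def
    loop_time_def power2_eq_square
  by (intro polynomial_intros)

section \<open>The approximation guarantee\<close>

lemma temporally_covers_iff_covby:
  assumes "(u, v, ts) \<in> set es" "\<forall>(u, v, ts)\<in>set es. distinct ts \<and> set ts = labels G {u, v}"
  shows "temporally_covers G a {u, v} \<longleftrightarrow> covby a (u, v, ts)"
  using assms by (cases a) (auto simp: temporally_covers_def)

text \<open>All edges covered by \<open>(w, t)\<close> contain \<open>w\<close>, so they have the
  form \<open>{w, x}\<close>; distinct edges have distinct other endpoints \<open>x\<close>. This is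
  what turns the harmonic bound into one in the number of vertices.\<close>

lemma length_covered_le:
  assumes G: "temporal_graph G"
    and es: "distinct (map (\<lambda>(u, v, ts). {u, v}) es)" "(\<lambda>(u, v, ts). {u, v}) ` set es = edges G"
  shows "length (covered a es) \<le> card (verts G)"
proof -
  obtain w t where a: "a = (w, t)"
    by (cases a)
  have fin: "finite (verts G)"
    using G by (simp add: temporal_graph_def)
  have "distinct (map (\<lambda>(u, v, ts). {u, v}) (covered a es))"
    using es(1) by (rule distinct_map_filter)
  then have "length (covered a es) = card ((\<lambda>(u, v, ts). {u, v}) ` set (covered a es))"
    using distinct_card[of "map (\<lambda>(u, v, ts). {u, v}) (covered a es)"] by simp
  also have "\<dots> \<le> card ((\<lambda>x. {w, x}) ` verts G)"
  proof (rule card_mono)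
    show "(\<lambda>(u, v, ts). {u, v}) ` set (covered a es) \<subseteq> (\<lambda>x. {w, x}) ` verts G"
    proof clarify
      fix u v ts
      assume e: "(u, v, ts) \<in> set (covered a es)"
      then have "{u, v} \<in> edges G"
        using imageI[of "(u, v, ts)" "set es" "\<lambda>(u, v, ts). {u, v}"] es(2) by simp
      then have "{u, v} \<subseteq> verts G"
        using G by (auto simp: temporal_graph_def)
      then show "{u, v} \<in> (\<lambda>x. {w, x}) ` verts G"
        using e a by auto
    qed
  qed (use fin in simp)
  also have "\<dots> \<le> card (verts G)"
    using fin by (rule card_image_le)
  finally show ?thesis .
qed

lemma run_greedy_prog_tgraph:
  assumes G: "temporal_graph G" and x: "encodes_tgraph x G"
  obtains out t where "run greedy_prog x = return_spmf (enc_list enc_app out, t)"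
    "t \<le> greedy_time ((val_size x + 1)\<^sup>2)"
    "temporal_vertex_cover G (set out)"
    "real (length out) \<le> (1 + ln (real (card (verts G)))) * real (min_tvc_card G)"
proof -
  obtain vs es where es: "x = Node (enc_list Leaf vs) (enc_list enc_edge es)"
    "distinct (map (\<lambda>(u, v, ts). {u, v}) es)" "(\<lambda>(u, v, ts). {u, v}) ` set es = edges G"
    "\<forall>(u, v, ts)\<in>set es. distinct ts \<and> set ts = labels G {u, v}"
    using x unfolding encodes_tgraph_def by (elim exE conjE) (rule that)
  have edge: "{u, v} \<in> edges G" "set ts = labels G {u, v}" if "(u, v, ts) \<in> set es" for u v ts
    using that es(4) imageI[of "(u, v, ts)" "set es" "\<lambda>(u, v, ts). {u, v}"] es(3) by auto
  have ts: "ts \<noteq> []" if "(u, v, ts) \<in> set es" for u v ts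
    using edge[OF that] G by (auto simp: temporal_graph_def)
  obtain out t where out: "run greedy_prog x = return_spmf (enc_list enc_app out, t)"
    "t \<le> greedy_time ((val_size x + 1)\<^sup>2)"
    "set out \<subseteq> {a. \<exists>e\<in>set es. covby a e}" "\<forall>e\<in>set es. \<exists>a\<in>set out. covby a e"
    "\<forall>C. finite C \<and> (\<forall>e\<in>set es. \<exists>a\<in>C. covby a e) \<longrightarrow>
      real (length out) \<le> (\<Sum>a\<in>C. harm (length (covered a es)))"
    by (rule run_greedy_prog[OF es(1)]) (erule ts, rule that)
  have covers: "(\<exists>a\<in>S. temporally_covers G a {u, v}) \<longleftrightarrow> (\<exists>a\<in>S. covby a (u, v, ts))"
    if "(u, v, ts) \<in> set es" for u v ts S
    using temporally_covers_iff_covby[OF that es(4)] by simp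
  \<comment> \<open>The edge set is finite because it is the image of a list; this makes the maximum
    in \<open>lifetime\<close> an upper bound for all labels.\<close>
  have fin: "finite (\<Union>e\<in>edges G. labels G e)"
    using G unfolding es(3)[symmetric] by (auto simp: temporal_graph_def es(3)[symmetric])
  have "set out \<subseteq> vertex_appearances G"
  proof
    fix a assume "a \<in> set out"
    then obtain u v ts w t where a: "a = (w, t)" "(u, v, ts) \<in> set es" "w \<in> {u, v}" "t \<in> set ts"
    proof -
      obtain u v ts where "(u, v, ts) \<in> set es" "covby a (u, v, ts)"
        using \<open>a \<in> set out\<close> out(3) by auto
      then show ?thesis
        using that by (cases a) auto
    qed
    then have e: "{u, v} \<in> edges G" "t \<in> labels G {u, v}"
      using edge by auto
    then have "w \<in> verts G" "0 < t"
      using G a(3) by (auto simp: temporal_graph_def intro!: gr0I)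
    moreover have "t \<le> lifetime G"
      unfolding lifetime_def using fin e by (intro Max_ge) auto
    ultimately show "a \<in> vertex_appearances G"
      using a(1) by (simp add: vertex_appearances_def)
  qed
  moreover have "\<exists>a\<in>set out. temporally_covers G a e" if e: "e \<in> edges G" for e
  proof -
    obtain u v ts where "e = {u, v}" "(u, v, ts) \<in> set es"
      using e unfolding es(3)[symmetric] by auto
    then show ?thesis
      using out(4) covers by blast
  qed
  ultimately have tvc: "temporal_vertex_cover G (set out)"
    by (simp add: temporal_vertex_cover_def)
  have finapp: "finite (vertex_appearances G)"
    using G by (simp add: vertex_appearances_def temporal_graph_def)
  then have "finite {S. temporal_vertex_cover G S}"
    by (rule finite_subset[rotated, OF finite_Pow_iff[THEN iffD2]])
      (auto simp: temporal_vertex_cover_def)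
  \<comment> \<open>The minimum is attained: the greedy output shows that covers exist, and all
    covers lie in a finite set.\<close>
  then have "min_tvc_card G \<in> card ` {S. temporal_vertex_cover G S}"
    unfolding min_tvc_card_def using tvc by (intro Min_in) auto
  then obtain C where C: "temporal_vertex_cover G C" "card C = min_tvc_card G"
    by force
  have C': "C \<subseteq> vertex_appearances G"
    using C(1) by (simp add: temporal_vertex_cover_def)
  have "\<exists>a\<in>C. covby a (u, v, ts)" if "(u, v, ts) \<in> set es" for u v ts
    using covers[OF that, of C] edge(1)[OF that] C(1) by (simp add: temporal_vertex_cover_def)
  then have "real (length out) \<le> (\<Sum>a\<in>C. harm (length (covered a es)))"
    using out(5) finite_subset[OF C' finapp] by auto
  also have "\<dots> \<le> (\<Sum>a\<in>C. 1 + ln (real (card (verts G))))"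
  proof (rule sum_mono)
    fix a assume "a \<in> C"
    \<comment> \<open>A member of \<open>C\<close> provides a vertex, as the logarithmic bound
      requires; for empty \<open>C\<close> both sums are 0.\<close>
    then have "0 < card (verts G)"
      using C' G by (auto simp: vertex_appearances_def temporal_graph_def card_gt_0_iff)
    have "harm (length (covered a es)) \<le> (harm (card (verts G)) :: real)"
      by (rule harm_mono[OF length_covered_le[OF G es(2,3)]])
    also have "\<dots> \<le> 1 + ln (real (card (verts G)))"
      using \<open>0 < card (verts G)\<close> by (rule harm_le_ln)
    finally show "harm (length (covered a es)) \<le> 1 + ln (real (card (verts G)))" .
  qed
  also have "\<dots> = (1 + ln (real (card (verts G)))) * real (min_tvc_card G)"
    by (simp add: C(2))
  finally show ?thesis
    by (intro that[OF out(1,2) tvc])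
qed

theorem theorem4:
  shows "\<exists>(P :: prog) (\<rho> :: nat \<Rightarrow> real).
    polynomial_time_on tgraph_instances P \<and>
    \<rho> \<in> O(\<lambda>n. ln (real n)) \<and>
    (\<forall>G x. temporal_graph G \<longrightarrow> encodes_tgraph x G \<longrightarrow>
       (\<forall>(y, t)\<in>set_spmf (run P x).
          \<exists>S. dec_appearances y = Some S \<and> temporal_vertex_cover G S) \<and>
       (\<integral>(y, t). real (card (the (dec_appearances y))) \<partial>measure_spmf (run P x))
         \<le> \<rho> (card (verts G)) * real (min_tvc_card G))"
proof (intro exI conjI allI impI)
  obtain p where p: "\<And>n. greedy_time ((n + 1)\<^sup>2) = poly p n"
    using polynomial_greedy_time unfolding polynomial_def by blast
  show "polynomial_time_on tgraph_instances greedy_prog"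
    unfolding polynomial_time_on_def
  proof (intro exI[of _ p] ballI)
    fix x assume "x \<in> tgraph_instances"
    then obtain G where "temporal_graph G" "encodes_tgraph x G"
      by (auto simp: tgraph_instances_def)
    then obtain out t where "run greedy_prog x = return_spmf (enc_list enc_app out, t)"
      "t \<le> greedy_time ((val_size x + 1)\<^sup>2)"
      by (rule run_greedy_prog_tgraph)
    then show "lossless_spmf (run greedy_prog x) \<and>
        (\<forall>(y, t)\<in>set_spmf (run greedy_prog x). t \<le> poly p (val_size x))"
      using p by simp
  qed
  \<comment> \<open>Only large \<open>n\<close> matter here: once \<open>ln n\<close> is at least 1,
    the factor is at most \<open>2 * ln n\<close>.\<close>
  show "(\<lambda>n. 1 + ln (real n)) \<in> O(\<lambda>n. ln (real n))"
    by real_asymp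
  fix G x
  assume "temporal_graph G" "encodes_tgraph x G"
  then obtain out t where run: "run greedy_prog x = return_spmf (enc_list enc_app out, t)"
    and tvc: "temporal_vertex_cover G (set out)"
    and len: "real (length out) \<le> (1 + ln (real (card (verts G)))) * real (min_tvc_card G)"
    by (rule run_greedy_prog_tgraph)
  show "\<forall>(y, t)\<in>set_spmf (run greedy_prog x).
      \<exists>S. dec_appearances y = Some S \<and> temporal_vertex_cover G S"
    using run tvc by (simp add: dec_appearances_enc_list)
  \<comment> \<open>The output distribution is a point mass, so the expectation is the single value;
    repetitions in the list could only make the decoded set smaller than the list.\<close>
  have "(\<integral>(y, t). real (card (the (dec_appearances y))) \<partial>measure_spmf (run greedy_prog x))
      = real (card (set out))"
    by (simp add: run measure_spmf_return_spmf integral_return dec_appearances_enc_list)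
  also have "\<dots> \<le> real (length out)"
    by (simp add: card_length)
  also note len
  finally show "(\<integral>(y, t). real (card (the (dec_appearances y))) \<partial>measure_spmf (run greedy_prog x))
      \<le> (1 + ln (real (card (verts G)))) * real (min_tvc_card G)" .
qed

end
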